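(* For each stage $t \in \mathbb{N}$ let $X_t$ be a Polish space (of actions), let $X = \prod_{t\in\mathbb{N}} X_t$ with the product topology, and let $u : X \to \mathbb{R}$ be a bounded Borel-measurable (payoff) function. Then the set of expected payoffs that can be obtained by Markov strategies is equal to the set of expected payoffs that can be obtained by eventually pure Markov strategies, that is, $$\{\mathbb{E}_\sigma[u] : \sigma \text{ is a Markov strategy}\} = \{\mathbb{E}_\sigma[u] : \sigma \text{ is an eventually pure Markov strategy}\}.$$
   Context: $\mathbb{N} = \{1,2,\ldots\}$. Decision problem: at each stage $t \in \mathbb{N}$ a decision maker chooses an action $x_t \in X_t$; if the sequence of chosen actions is $(x_1,x_2,\ldots)\in X$, her payoff is $u(x_1,x_2,\ldots)$. A Markov strategy is a product Borel probability measure $\sigma = \bigotimes_{t\in\mathbb{N}}\sigma_t$ on $X$, where $\sigma_t$ is a Borel probability measure on $X_t$ for each $t \in \mathbb{N}$. It is called eventually pure if $\sigma_t$ is a Dirac measure for all but finitely many $t \in \mathbb{N}$. $\mathbb{E}_\sigma[u]$ denotes the expectation of $u$ under $\sigma$. *)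

theory Defs
  imports "HOL-Probability.Probability"
begin

text \<open>
  The library class for Polish spaces makes a whole type Polish, so it cannot describe a
  stage-dependent family of spaces. Here the action spaces are topologies in the sense of
  \<^theory>\<open>HOL-Analysis.Abstract_Topology\<close>, with carrier \<^term>\<open>topspace (X t)\<close>.
\<close>

definition polish_top :: "'a topology \<Rightarrow> bool" where
  "polish_top T \<longleftrightarrow> completely_metrizable_space T \<and> separable_space T"

definition borel_of :: "'a topology \<Rightarrow> 'a measure" where
  "borel_of T = sigma (topspace T) {U. openin T U}"

definition borel_prob :: "'a topology \<Rightarrow> 'a measure \<Rightarrow> bool" where
  "borel_prob T \<mu> \<longleftrightarrow> prob_space \<mu> \<and> sets \<mu> = sets (borel_of T)"

definition dirac_measure :: "'a topology \<Rightarrow> 'a measure \<Rightarrow> bool" where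
  "dirac_measure T \<mu> \<longleftrightarrow> (\<exists>a\<in>topspace T. \<mu> = return (borel_of T) a)"

text \<open>
  A strategy is the product measure itself. Its sigma-algebra is the product sigma-algebra, which
  for Polish factors is the Borel sigma-algebra of the product topology: see
  \<open>markov_strategy_borel_prob\<close> below. The factors are the marginals of the product measure, hence
  determined by it, so quantifying them existentially is unambiguous. Stages are
  numbered from 0.
\<close>

definition markov_strategy ::
    "(nat \<Rightarrow> 'a topology) \<Rightarrow> (nat \<Rightarrow> 'a) measure \<Rightarrow> bool" where
  "markov_strategy X \<sigma> \<longleftrightarrow>
     (\<exists>s. (\<forall>t. borel_prob (X t) (s t)) \<and> \<sigma> = Pi\<^sub>M UNIV s)"

definition eventually_pure_markov_strategy ::
    "(nat \<Rightarrow> 'a topology) \<Rightarrow> (nat \<Rightarrow> 'a) measure \<Rightarrow> bool" where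
  "eventually_pure_markov_strategy X \<sigma> \<longleftrightarrow>
     (\<exists>s. (\<forall>t. borel_prob (X t) (s t)) \<and> \<sigma> = Pi\<^sub>M UNIV s \<and>
          finite {t. \<not> dirac_measure (X t) (s t)})"

lemma space_borel_of [simp]: "space (borel_of T) = topspace T"
  by (simp add: borel_of_def space_measure_of_conv)

lemma sets_borel_of: "sets (borel_of T) = sigma_sets (topspace T) {U. openin T U}"
  unfolding borel_of_def by (rule sets_measure_of) (auto dest: openin_subset)

lemma openin_in_sets_borel_of: "openin T U \<Longrightarrow> U \<in> sets (borel_of T)"
  by (simp add: sets_borel_of sigma_sets.Basic)

lemma polish_top_second_countable:
  assumes "polish_top T"
  shows "second_countable T"
proof -
  obtain M d where md: "Metric_space M d" and T: "T = Metric_space.mtopology M d"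
    using assms by (auto simp: polish_top_def completely_metrizable_space_def)
  interpret Metric_space M d by (rule md)
  obtain C where C: "countable C" "C \<subseteq> M" "mtopology closure_of C = M"
    using assms by (auto simp: polish_top_def separable_space_def T)
  define B where "B = (\<lambda>(x, q). mball x q) ` (C \<times> (\<rat> :: real set))"
  have "\<exists>V\<in>B. x \<in> V \<and> V \<subseteq> U" if U: "openin mtopology U" "x \<in> U" for U x
  proof -
    obtain r where r: "r > 0" "mball x r \<subseteq> U" and x: "x \<in> M"
      using U by (meson openin_mtopology subsetD)
    obtain q where q: "q \<in> \<rat>" "0 < q" "q < r / 2"
      using Rats_dense_in_real[of 0 "r / 2"] r(1) by auto
    have "x \<in> mtopology closure_of C"
      using C x by simp
    then obtain c where c: "c \<in> C" "c \<in> mball x q"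
      using q(2) x by (auto simp: in_closure_of)
    have "mball c q \<subseteq> mball x r"
    proof
      fix y assume y: "y \<in> mball c q"
      then have "d x y \<le> d x c + d c y"
        using triangle c x by auto
      also have "\<dots> < r"
        using c y q by auto
      finally show "y \<in> mball x r"
        using x y by auto
    qed
    moreover have "x \<in> mball c q"
      using c by (auto simp: commute)
    moreover have "mball c q \<in> B"
      using c q by (force simp: B_def)
    ultimately show ?thesis
      using r by blast
  qed
  moreover have "countable B"
    unfolding B_def using C by (intro countable_image countable_SIGMA countable_rat) auto
  moreover have "\<forall>V\<in>B. openin mtopology V"
    by (auto simp: B_def)
  ultimately show ?thesis
    unfolding second_countable_def T by blast
qed

lemma sets_PiM_borel_of:
  fixes X :: "nat \<Rightarrow> 'a topology"
  assumes "\<And>t. polish_top (X t)"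
  shows "sets (Pi\<^sub>M UNIV (\<lambda>t. borel_of (X t))) = sets (borel_of (product_topology X UNIV))"
    (is "sets ?P = sets ?B")
proof (rule antisym)
  have "(\<lambda>f t. f t) \<in> ?B \<rightarrow>\<^sub>M ?P"
  proof (rule measurable_PiM_single')
    fix t
    show "(\<lambda>f. f t) \<in> ?B \<rightarrow>\<^sub>M borel_of (X t)"
      unfolding borel_of_def[of "X t"]
    proof (rule measurable_measure_of)
      fix U assume "U \<in> {U. openin (X t) U}"
      then have "openin (product_topology X UNIV)
          {f \<in> topspace (product_topology X UNIV). f t \<in> U}"
        using continuous_map_product_projection[of t UNIV X]
        by (auto simp: continuous_map_def)
      then show "(\<lambda>f. f t) -` U \<inter> space ?B \<in> sets ?B"
        by (auto dest!: openin_in_sets_borel_of simp: Collect_conj_eq vimage_def Int_commute)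
    qed (auto dest: openin_subset)
  qed auto
  then have id: "id \<in> ?B \<rightarrow>\<^sub>M ?P"
    by (simp add: id_def)
  show "sets ?P \<subseteq> sets ?B"
  proof
    fix A assume A: "A \<in> sets ?P"
    then have "A \<subseteq> space ?B"
      using sets.sets_into_space[OF A] by (simp add: space_PiM)
    with measurable_sets[OF id A] show "A \<in> sets ?B"
      by (simp add: Int_absorb2)
  qed
next
  have "\<forall>t. \<exists>B. countable B \<and> (\<forall>V\<in>B. openin (X t) V) \<and>
      (\<forall>U x. openin (X t) U \<and> x \<in> U \<longrightarrow> (\<exists>V\<in>B. x \<in> V \<and> V \<subseteq> U))"
    using polish_top_second_countable[OF assms] unfolding second_countable_def by blast
  then obtain B where B: "\<And>t. countable (B t)" "\<And>t V. V \<in> B t \<Longrightarrow> openin (X t) V"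
    "\<And>t U x. openin (X t) U \<Longrightarrow> x \<in> U \<Longrightarrow> \<exists>V\<in>B t. x \<in> V \<and> V \<subseteq> U"
    by metis
  define cyl where "cyl J V = (\<Pi>\<^sub>E t\<in>UNIV. if t \<in> J then V t else topspace (X t))"
    for J :: "nat set" and V
  define K where "K = (\<Union>J\<in>Collect finite. cyl J ` (Pi\<^sub>E J B))"
  have "countable K"
    unfolding K_def
    by (intro countable_UN countable_Collect_finite countable_image countable_PiE) (auto simp: B)
  have K: "C \<in> sets ?P" if "C \<in> K" for C
  proof -
    obtain J V where J: "V \<in> Pi\<^sub>E J B" "C = cyl J V"
      using \<open>C \<in> K\<close> by (auto simp: K_def)
    show ?thesis
      unfolding J(2) cyl_def
      by (rule sets_PiM_I_countable)
         (use J(1) B(2) in \<open>auto intro!: openin_in_sets_borel_of simp: PiE_iff\<close>)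
  qed
  have "U \<in> sets ?P" if U: "openin (product_topology X UNIV) U" for U
  proof -
    have *: "\<exists>C\<in>K. x \<in> C \<and> C \<subseteq> U" if "x \<in> U" for x
    proof -
      obtain W where W: "finite {i. W i \<noteq> topspace (X i)}" "\<And>i. openin (X i) (W i)"
          "x \<in> Pi\<^sub>E UNIV W" "Pi\<^sub>E UNIV W \<subseteq> U"
        using U \<open>x \<in> U\<close> unfolding openin_product_topology_alt by auto
      define J where "J = {i. W i \<noteq> topspace (X i)}"
      have "\<forall>i. \<exists>V\<in>B i. x i \<in> V \<and> V \<subseteq> W i"
        using B(3) W by (auto simp: PiE_iff)
      then obtain V where V: "\<And>i. V i \<in> B i" "\<And>i. x i \<in> V i" "\<And>i. V i \<subseteq> W i"
        by metis
      have c: "cyl J (restrict V J) = (\<Pi>\<^sub>E t\<in>UNIV. if t \<in> J then V t else W t)"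
        unfolding cyl_def by (intro PiE_cong) (auto simp: J_def)
      have "cyl J (restrict V J) \<in> K"
        unfolding K_def using W(1) V(1) by (auto simp: J_def intro!: imageI)
      moreover have "x \<in> cyl J (restrict V J)"
        unfolding c using V W by (auto simp: PiE_iff)
      moreover have "cyl J (restrict V J) \<subseteq> Pi\<^sub>E UNIV W"
        unfolding c using V(3) by (intro PiE_mono) auto
      ultimately show ?thesis
        using W(4) by (meson subset_trans)
    qed
    have "\<Union>{C \<in> K. C \<subseteq> U} = U"
      using * by (intro equalityI subsetI) auto
    moreover have "\<Union>{C \<in> K. C \<subseteq> U} \<in> sets ?P"
      using \<open>countable K\<close> K by (intro sets.countable_Union) auto
    ultimately show ?thesis
      by simp
  qed
  then show "sets ?B \<subseteq> sets ?P"
    unfolding sets_borel_of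
    using sets.sigma_sets_subset[of "{U. openin (product_topology X UNIV) U}" ?P]
    by (auto simp: space_PiM)
qed

lemma markov_strategy_borel_prob:
  assumes "\<And>t. polish_top (X t)" "markov_strategy X \<sigma>"
  shows "borel_prob (product_topology X UNIV) \<sigma>"
proof -
  obtain s where s: "\<And>t. borel_prob (X t) (s t)" "\<sigma> = Pi\<^sub>M UNIV s"
    using assms(2) by (auto simp: markov_strategy_def)
  have "sets \<sigma> = sets (Pi\<^sub>M UNIV (\<lambda>t. borel_of (X t)))"
    unfolding s(2) using s(1) by (intro sets_PiM_cong) (auto simp: borel_prob_def)
  moreover have "prob_space \<sigma>"
    unfolding s(2) using s(1) by (intro prob_space_PiM) (auto simp: borel_prob_def)
  ultimately show ?thesis
    using sets_PiM_borel_of[OF assms(1)] by (simp add: borel_prob_def)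
qed

end

theory Submission
  imports Defs
begin

text \<open>
  Let \<open>\<sigma>\<close> be a Markov strategy with expected payoff \<open>v\<close>, and let \<open>x\<close>, \<open>y\<close> be two sequences of
  actions that differ at most at stage \<open>t\<close>. If \<open>u x \<le> v \<le> u y\<close>, then playing \<open>x\<close> but tossing a
  suitably biased coin between \<open>x t\<close> and \<open>y t\<close> at stage \<open>t\<close> is an eventually pure strategy with
  payoff exactly \<open>v\<close> (\<open>eventually_pure_attains_between\<close>).

  Suppose that no eventually pure strategy has payoff \<open>v\<close>. The case \<open>x = y\<close> shows that \<open>u\<close> never
  takes the value \<open>v\<close>, and the general case shows that no change of a single action moves the payoff
  from one side of \<open>v\<close> to the other. Hence the event \<open>u > v\<close> is insensitive to changes of finitely
  many coordinates. Under the product measure \<open>\<sigma>\<close> such an event has probability 0 or 1 by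
  Kolmogorov's law (\<open>PiM_0_1_law\<close>). So \<open>\<sigma>\<close>-almost surely \<open>u < v\<close>, or \<open>\<sigma>\<close>-almost
  surely \<open>u > v\<close>, and either contradicts that the expectation of \<open>u\<close> is \<open>v\<close>.

  The argument yields a strategy that randomizes in at most one stage.
\<close>

section \<open>A zero-one law for product measures\<close>

lemma indep_vars_PiM_components:
  assumes "\<And>i::'i. prob_space (M i)"
  shows "prob_space.indep_vars (Pi\<^sub>M UNIV M) M (\<lambda>i x. x i) UNIV"
proof -
  interpret prob_space "Pi\<^sub>M UNIV M"
    by (intro prob_space_PiM assms)
  have "distr (Pi\<^sub>M UNIV M) (Pi\<^sub>M UNIV M) (\<lambda>x. \<lambda>i\<in>UNIV. x i) = Pi\<^sub>M UNIV M"
    by (simp add: restrict_def distr_id)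
  also have "\<dots> = (\<Pi>\<^sub>M i\<in>UNIV. distr (Pi\<^sub>M UNIV M) (M i) (\<lambda>x. x i))"
    by (intro PiM_cong) (auto simp: distr_PiM_component assms)
  finally show ?thesis
    by (subst indep_vars_iff_distr_eq_PiM) auto
qed

lemma one_coordinate_changes_imp_finite_changes:
  fixes x y :: "nat \<Rightarrow> 'a"
  assumes step: "\<And>x i a. x \<in> (\<Pi>\<^sub>E i\<in>UNIV. S i) \<Longrightarrow> a \<in> S i \<Longrightarrow> P (x(i := a)) \<longleftrightarrow> P x"
    and "x \<in> (\<Pi>\<^sub>E i\<in>UNIV. S i)" "y \<in> (\<Pi>\<^sub>E i\<in>UNIV. S i)"
  shows "P (\<lambda>i. if i < n then y i else x i) \<longleftrightarrow> P x"
proof (induction n)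
  case (Suc n)
  let ?z = "\<lambda>n i. if i < n then y i else x i"
  have "?z (Suc n) = (?z n)(n := y n)"
    by (auto simp: fun_eq_iff less_Suc_eq)
  moreover have "?z n \<in> (\<Pi>\<^sub>E i\<in>UNIV. S i)" "y n \<in> S n"
    using assms(2,3) by (auto simp: PiE_iff)
  ultimately show ?case
    using step Suc by metis
qed simp

text \<open>
  Fix a point \<open>a\<close>. Replacing the first \<open>n\<close> coordinates by those of \<open>a\<close> is measurable with respect to
  the remaining coordinates, and \<open>A\<close> is its own preimage under this map. So \<open>A\<close> belongs to the
  sigma-algebra generated by the coordinates from \<open>n\<close> on, for every \<open>n\<close>.
\<close>

lemma PiM_0_1_law:
  fixes M :: "nat \<Rightarrow> 'a measure"
  assumes M: "\<And>i. prob_space (M i)"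
    and A: "A \<in> sets (Pi\<^sub>M UNIV M)"
    and inv: "\<And>x i a. x \<in> space (Pi\<^sub>M UNIV M) \<Longrightarrow> a \<in> space (M i) \<Longrightarrow> x(i := a) \<in> A \<longleftrightarrow> x \<in> A"
  shows "measure (Pi\<^sub>M UNIV M) A = 0 \<or> measure (Pi\<^sub>M UNIV M) A = 1"
proof -
  let ?P = "Pi\<^sub>M UNIV M" and ?\<Omega> = "\<Pi>\<^sub>E i\<in>UNIV. space (M i)"
  interpret prob_space ?P
    by (intro prob_space_PiM M)
  define F where
    "F i = sigma_sets (space ?P) {(\<lambda>x. x i) -` B \<inter> space ?P | B. B \<in> sets (M i)}" for i
  have "sigma_algebra (space ?P) (F i)" for i
    unfolding F_def by (intro sigma_algebra_sigma_sets) auto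
  moreover have "indep_sets F UNIV"
    using indep_vars_PiM_components[of M, OF M] unfolding indep_vars_def F_def by simp
  moreover have "A \<in> tail_events F"
    unfolding tail_events_def
  proof
    fix n
    let ?N = "sigma (space ?P) (\<Union>(F ` {n..}))"
    have F_sub: "\<Union>(F ` {n..}) \<subseteq> Pow (space ?P)"
      unfolding F_def by (auto dest!: sigma_sets_into_sp[rotated])
    have coord: "(\<lambda>x. x i) \<in> ?N \<rightarrow>\<^sub>M M i" if "n \<le> i" for i
    proof (rule measurableI)
      fix B assume "B \<in> sets (M i)"
      then have "(\<lambda>x. x i) -` B \<inter> space ?P \<in> F i"
        unfolding F_def by (intro sigma_sets.Basic) auto
      then show "(\<lambda>x. x i) -` B \<inter> space ?N \<in> sets ?N"
        using F_sub that by (auto simp: space_measure_of_conv sets_measure_of)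
    qed (auto simp: space_measure_of_conv space_PiM)
    obtain a where a: "a \<in> ?\<Omega>"
      using not_empty by (auto simp: space_PiM)
    have ai: "a i \<in> space (M i)" for i
      using a by auto
    let ?f = "\<lambda>x i. if i < n then a i else x i"
    have "?f \<in> ?N \<rightarrow>\<^sub>M ?P"
    proof (rule measurable_PiM_single')
      fix i show "(\<lambda>x. ?f x i) \<in> ?N \<rightarrow>\<^sub>M M i"
        using coord[of i] ai by (cases "i < n") auto
    qed (use ai in \<open>auto simp: space_measure_of_conv space_PiM PiE_iff\<close>)
    from measurable_sets[OF this A] have "?f -` A \<inter> space ?P \<in> sets ?N"
      by (simp add: space_measure_of_conv)
    moreover have "?f -` A \<inter> space ?P = A"
      using one_coordinate_changes_imp_finite_changes
          [where S = "\<lambda>i. space (M i)" and P = "\<lambda>x. x \<in> A" and y = a and n = n]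
        inv a sets.sets_into_space[OF A]
      by (auto simp: space_PiM)
    ultimately show "A \<in> sigma_sets (space ?P) (\<Union>(F ` {n..}))"
      using F_sub by (simp add: sets_measure_of)
  qed
  ultimately show ?thesis
    by (rule kolmogorov_0_1_law)
qed

section \<open>Mixing two actions at a single stage\<close>

lemma AE_return_borel_of_eq:
  assumes "polish_top T" "a \<in> topspace T"
  shows "AE z in return (borel_of T) a. z = a"
proof -
  have "closedin T {a}"
    using assms unfolding polish_top_def
    by (intro closedin_Hausdorff_singleton metrizable_imp_Hausdorff_space
        completely_metrizable_imp_metrizable_space) auto
  then have "topspace T - {a} \<in> sets (borel_of T)"
    by (intro openin_in_sets_borel_of) auto
  then have "space (borel_of T) - (topspace T - {a}) \<in> sets (borel_of T)"
    by blast
  moreover have "space (borel_of T) - (topspace T - {a}) = {z \<in> space (borel_of T). z = a}"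
    using assms(2) by auto
  ultimately have "Measurable.pred (borel_of T) (\<lambda>z. z = a)"
    by (simp add: pred_def)
  then show ?thesis
    using assms(2) by (subst AE_return) auto
qed

text \<open>
  Singletons are measurable in a Polish space and there are only countably many stages, so almost
  every play agrees with \<open>x\<close> at all stages other than \<open>t\<close> simultaneously.
\<close>

lemma integral_PiM_one_random_stage:
  fixes X :: "nat \<Rightarrow> 'a topology" and u :: "(nat \<Rightarrow> 'a) \<Rightarrow> real"
  assumes X: "\<And>i. polish_top (X i)"
    and u: "u \<in> borel_measurable (Pi\<^sub>M UNIV (\<lambda>i. borel_of (X i)))"
    and x: "x \<in> (\<Pi>\<^sub>E i\<in>UNIV. topspace (X i))"
    and s: "\<And>i. borel_prob (X i) (s i)" "\<And>i. i \<noteq> t \<Longrightarrow> s i = return (borel_of (X i)) (x i)"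
  shows "(\<integral>z. u z \<partial>Pi\<^sub>M UNIV s) = (\<integral>a. u (x(t := a)) \<partial>s t)"
proof -
  let ?P = "Pi\<^sub>M UNIV s"
  have prob: "prob_space (s i)" and sets_s: "sets (s i) = sets (borel_of (X i))" for i
    using s(1) by (auto simp: borel_prob_def)
  have space_s: "space (s i) = topspace (X i)" for i
    using sets_eq_imp_space_eq[OF sets_s[of i]] by simp
  have xi: "x i \<in> topspace (X i)" for i
    using x by auto
  have sets_P: "sets ?P = sets (Pi\<^sub>M UNIV (\<lambda>i. borel_of (X i)))"
    by (intro sets_PiM_cong) (auto simp: sets_s)
  have u_P[measurable]: "u \<in> borel_measurable ?P"
    using u measurable_cong_sets[OF sets_P refl] by blast
  have upd[measurable]: "(\<lambda>a. x(t := a)) \<in> s t \<rightarrow>\<^sub>M ?P"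
    unfolding fun_upd_def
  proof (rule measurable_PiM_single')
    fix i show "(\<lambda>a. if i = t then a else x i) \<in> s t \<rightarrow>\<^sub>M s i"
      using xi by (cases "i = t") (auto simp: space_s)
  qed (use xi in \<open>auto simp: space_s\<close>)
  have comp[measurable]: "(\<lambda>z. z t) \<in> ?P \<rightarrow>\<^sub>M s t"
    by simp
  have "AE z in ?P. z i = x i" if "i \<noteq> t" for i
    using AE_return_borel_of_eq[OF X, of "x i" i, folded s(2)[OF that]] xi
    by (intro AE_PiM_component prob) auto
  then have "AE z in ?P. \<forall>i. i \<noteq> t \<longrightarrow> z i = x i"
    by (subst AE_all_countable) auto
  then have "AE z in ?P. u z = u (x(t := z t))"
  proof eventually_elim
    case (elim z)
    then have "z = x(t := z t)"
      by (auto simp: fun_eq_iff)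
    then show ?case
      by simp
  qed
  then have "(\<integral>z. u z \<partial>?P) = (\<integral>z. u (x(t := z t)) \<partial>?P)"
    by (intro integral_cong_AE) measurable
  also have "\<dots> = (\<integral>a. u (x(t := a)) \<partial>distr ?P (s t) (\<lambda>z. z t))"
    by (subst integral_distr) measurable
  also have "distr ?P (s t) (\<lambda>z. z t) = s t"
    by (intro distr_PiM_component prob) auto
  finally show ?thesis .
qed

lemma eventually_pure_attains_between:
  fixes X :: "nat \<Rightarrow> 'a topology" and u :: "(nat \<Rightarrow> 'a) \<Rightarrow> real"
  assumes X: "\<And>i. polish_top (X i)"
    and u: "u \<in> borel_measurable (Pi\<^sub>M UNIV (\<lambda>i. borel_of (X i)))"
    and x: "x \<in> (\<Pi>\<^sub>E i\<in>UNIV. topspace (X i))" and a: "a \<in> topspace (X t)"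
    and v: "v \<in> closed_segment (u x) (u (x(t := a)))"
  shows "\<exists>\<sigma>. eventually_pure_markov_strategy X \<sigma> \<and> (\<integral>z. u z \<partial>\<sigma>) = v"
proof -
  obtain p where p: "0 \<le> p" "p \<le> 1" "v = (1 - p) * u x + p * u (x(t := a))"
    using v by (auto simp: in_segment)
  define s where "s i = (if i = t
      then distr (measure_pmf (bernoulli_pmf p)) (borel_of (X t)) (\<lambda>b. if b then a else x t)
      else return (borel_of (X i)) (x i))" for i
  have xi: "x i \<in> topspace (X i)" for i
    using x by auto
  have coin: "(\<lambda>b. if b then a else x t) \<in> measure_pmf (bernoulli_pmf p) \<rightarrow>\<^sub>M borel_of (X t)"
    using a xi by auto
  have s: "borel_prob (X i) (s i)" for i
    using coin xi unfolding borel_prob_def s_def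
    by (auto intro!: prob_space_return measure_pmf.prob_space_distr)
  have "{i. \<not> dirac_measure (X i) (s i)} \<subseteq> {t}"
    using xi by (auto simp: s_def dirac_measure_def)
  then have "finite {i. \<not> dirac_measure (X i) (s i)}"
    using finite_subset by blast
  with s have "eventually_pure_markov_strategy X (Pi\<^sub>M UNIV s)"
    unfolding eventually_pure_markov_strategy_def by blast
  moreover have "(\<integral>z. u z \<partial>Pi\<^sub>M UNIV s) = v"
  proof -
    have upd: "(\<lambda>c. x(t := c)) \<in> borel_of (X t) \<rightarrow>\<^sub>M Pi\<^sub>M UNIV (\<lambda>i. borel_of (X i))"
      unfolding fun_upd_def
    proof (rule measurable_PiM_single')
      fix i show "(\<lambda>c. if i = t then c else x i) \<in> borel_of (X t) \<rightarrow>\<^sub>M borel_of (X i)"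
        using xi by (cases "i = t") auto
    qed (use xi in auto)
    have "(\<integral>z. u z \<partial>Pi\<^sub>M UNIV s) = (\<integral>c. u (x(t := c)) \<partial>s t)"
      using X u x s by (rule integral_PiM_one_random_stage) (simp add: s_def)
    also have "\<dots> = (\<integral>b. u (x(t := if b then a else x t)) \<partial>measure_pmf (bernoulli_pmf p))"
      unfolding s_def using measurable_compose[OF upd u] coin by (simp add: integral_distr)
    also have "\<dots> = v"
      using p by (simp add: algebra_simps)
    finally show ?thesis .
  qed
  ultimately show ?thesis
    by blast
qed

section \<open>Markov strategies and eventually pure ones have the same payoffs\<close>

lemma eventually_pure_attains_markov_payoff:
  fixes X :: "nat \<Rightarrow> 'a topology" and u :: "(nat \<Rightarrow> 'a) \<Rightarrow> real"
  assumes X: "\<And>i. polish_top (X i)"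
    and u: "u \<in> borel_measurable (borel_of (product_topology X UNIV))"
    and bound: "\<And>x. x \<in> topspace (product_topology X UNIV) \<Longrightarrow> \<bar>u x\<bar> \<le> B"
    and \<sigma>: "markov_strategy X \<sigma>"
  shows "\<exists>\<tau>. eventually_pure_markov_strategy X \<tau> \<and> (\<integral>x. u x \<partial>\<tau>) = (\<integral>x. u x \<partial>\<sigma>)"
proof (rule ccontr)
  assume none: "\<not> ?thesis"
  define v where "v = (\<integral>x. u x \<partial>\<sigma>)"
  let ?\<Omega> = "\<Pi>\<^sub>E i\<in>UNIV. topspace (X i)"
  obtain s where s: "\<And>i. borel_prob (X i) (s i)" and \<sigma>_eq: "\<sigma> = Pi\<^sub>M UNIV s"
    using \<sigma> by (auto simp: markov_strategy_def)
  have space_s: "space (s i) = topspace (X i)" for i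
    using s[of i] sets_eq_imp_space_eq[of "s i" "borel_of (X i)"] by (simp add: borel_prob_def)
  have space_\<sigma>: "space \<sigma> = ?\<Omega>"
    by (simp add: \<sigma>_eq space_PiM space_s)
  have \<sigma>_borel: "borel_prob (product_topology X UNIV) \<sigma>"
    using X \<sigma> by (rule markov_strategy_borel_prob)
  then interpret prob_space \<sigma>
    by (simp add: borel_prob_def)
  have u_\<sigma>[measurable]: "u \<in> borel_measurable \<sigma>"
    using u \<sigma>_borel measurable_cong_sets unfolding borel_prob_def by blast
  have int: "integrable \<sigma> u"
    using bound by (intro integrable_const_bound[of _ B]) (auto simp: space_\<sigma>)
  have "u \<in> borel_measurable (Pi\<^sub>M UNIV (\<lambda>i. borel_of (X i)))"
    using u measurable_cong_sets[OF sets_PiM_borel_of[of X, OF X] refl] by blast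
  then have not_between: "v \<notin> closed_segment (u x) (u (x(i := a)))"
    if "x \<in> ?\<Omega>" "a \<in> topspace (X i)" for x i a
    using eventually_pure_attains_between[OF X _ that] none unfolding v_def by blast
  have neq: "u x \<noteq> v" if "x \<in> ?\<Omega>" for x
    using not_between[OF that, of "x 0" 0] that by auto
  define A where "A = {x \<in> space \<sigma>. v < u x}"
  have "x(i := a) \<in> A \<longleftrightarrow> x \<in> A" if "x \<in> ?\<Omega>" "a \<in> topspace (X i)" for x i a
  proof -
    have "x(i := a) \<in> ?\<Omega>"
      using that by auto
    then show ?thesis
      using that not_between[OF that]
      by (auto simp: A_def space_\<sigma> closed_segment_eq_real_ivl split: if_splits)
  qed
  moreover have A: "A \<in> sets \<sigma>"
    unfolding A_def by measurable
  ultimately have "prob A = 0 \<or> prob A = 1"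
    using PiM_0_1_law[of s A] s
    unfolding \<sigma>_eq[symmetric] by (auto simp: borel_prob_def space_s space_\<sigma>)
  then consider "AE x in \<sigma>. x \<notin> A" | "AE x in \<sigma>. x \<in> A"
    using A prob_eq_0 prob_eq_1 by blast
  then show False
  proof cases
    case 1
    then have "AE x in \<sigma>. u x < v"
      using AE_space by eventually_elim (use neq in \<open>force simp: A_def space_\<sigma>\<close>)
    from expectation_less[OF int this] show False
      by (simp add: v_def)
  next
    case 2
    then have "AE x in \<sigma>. v < u x"
      by eventually_elim (simp add: A_def)
    from expectation_greater[OF int this] show False
      by (simp add: v_def)
  qed
qed

theorem mainTheorem4:
  fixes X :: "nat \<Rightarrow> 'a topology" and u :: "(nat \<Rightarrow> 'a) \<Rightarrow> real"
  assumes "\<And>t. polish_top (X t)"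
    and "u \<in> borel_measurable (borel_of (product_topology X UNIV))"
    and "\<exists>B. \<forall>x\<in>topspace (product_topology X UNIV). \<bar>u x\<bar> \<le> B"
  shows "{(\<integral>x. u x \<partial>\<sigma>) | \<sigma>. markov_strategy X \<sigma>} =
         {(\<integral>x. u x \<partial>\<sigma>) | \<sigma>. eventually_pure_markov_strategy X \<sigma>}"
proof -
  obtain B where B: "\<And>x. x \<in> topspace (product_topology X UNIV) \<Longrightarrow> \<bar>u x\<bar> \<le> B"
    using assms(3) by blast
  have "markov_strategy X \<sigma>" if "eventually_pure_markov_strategy X \<sigma>" for \<sigma>
    using that unfolding markov_strategy_def eventually_pure_markov_strategy_def by blast
  moreover have "\<exists>\<tau>. eventually_pure_markov_strategy X \<tau> \<and> (\<integral>x. u x \<partial>\<tau>) = (\<integral>x. u x \<partial>\<sigma>)"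
    if "markov_strategy X \<sigma>" for \<sigma>
    using assms(1,2) B that by (rule eventually_pure_attains_markov_payoff)
  ultimately show ?thesis
    by (intro equalityI subsetI; clarsimp; metis)
qed

end
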